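(* Let $p$ be a prime. Let $r\ge 1$, $s\ge 1$, let $1=m_0<m_1<\dots<m_r$ be integers and $l_0\ge l_1>l_2>\dots>l_r\ge s$ integers, and put $$\lambda=(l_0+s,\,l_1^{m_1-1},\,l_2^{m_2-m_1},\ldots,l_r^{m_r-m_{r-1}}),\qquad \mu=(l_0,\,l_1^{m_1-1},\,l_2^{m_2-m_1},\ldots,l_r^{m_r-m_{r-1}},\,s).$$ Suppose that $e>0$ and $\gamma_1,\dots,\gamma_r$ are integers such that the following two conditions hold (with $f$, $g_{\mu,i,t}$, $\nu(\mu,d,t)$, "nice" and "pseudo-standard" as defined in the context, $f$ and $g_{\mu,i,t}$ being formed from these $\gamma_i$): (i) for some nice pseudo-standard $\lambda$-tableau $T$ of type $\mu$ the integer $f(T)$ is not divisible by $p^e$; (ii) for all $0\le i\le r$ and $1\le t\le \mu_{m_i+1}$, and all pseudo-standard $\lambda$-tableaux $S$ of type $\nu(\mu,m_i,t)$, the integer $g_{\mu,i,t}(S)$ is divisible by $p^e$. Then $$\gamma_i\equiv l_0-l_i+m_i+s-1 \pmod p\qquad\text{for } 1\le i\le r,$$ and $$l_0+m_r\equiv 0\pmod p .$$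
   Context: Exponents in partitions denote repeated parts; $\lambda_i$ denotes the $i$th part of $\lambda$, with $\lambda_i=0$ beyond the last part. A $\lambda$-tableau of type (weight) $\nu$, where $\nu$ is a composition of $|\lambda|$, is a filling of the Young diagram of $\lambda$ with positive integers such that exactly $\nu_i$ entries equal $i$ for each $i$. For a tableau $T$, let $T^i_j$ be the number of entries equal to $i$ in row $j$, and let $T_h=\sum_{j>h}T^j_h$ (the number of entries in row $h$ that are greater than $h$). For integers $a$ and $b\geq 0$ set $a^{b\downarrow}=\prod_{i=0}^{b-1}(a-i)$ and $a^{b\uparrow}=\prod_{i=0}^{b-1}(a+i)$. For $1\le i\le r$ define $$n_i(T)=\sum_{h=m_{i-1}+1}^{m_i}T_h,\qquad c_i(T)=\gamma_i^{(s-n_i(T))\downarrow}\prod_{h=m_{i-1}+1}^{m_i}T_h!,\qquad f(T)=\prod_{i=1}^r c_i(T).$$ Given integers $d\ge 1$ and $0\le t\le \mu_{d+1}$, the composition $\nu=\nu(\mu,d,t)$ is defined by $\nu_d=\mu_d+t$, $\nu_{d+1}=\mu_{d+1}-t$, and $\nu_i=\mu_i$ otherwise. For $0\le b\le r$ and a $\lambda$-tableau $S$ of type $\nu(\mu,m_b,t)$ define $g_{\mu,b,t}(S)$ as follows (where $f(S)/c_b(S)$ means $\prod_{i\ne b}c_i(S)$): - if $b=0$: $\; g_{\mu,0,t}(S)=f(S)\,\dfrac{(l_0-l_1+m_1-1+s-\gamma_1)^{t\uparrow}}{t!}$; - if $0<b<r$: $\; g_{\mu,b,t}(S)=\dfrac{f(S)}{c_b(S)}\cdot\dfrac{(l_b-l_{b+1}+m_{b+1}-m_b+\gamma_b-\gamma_{b+1})^{t\uparrow}}{t!}\cdot\gamma_b^{(s-n_b(S)-t)\downarrow}\,(S_{m_b}+t)!\prod_{j=m_{b-1}+1}^{m_b-1}S_j!$;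 - if $b=r$: $\; g_{\mu,r,t}(S)=\dfrac{f(S)}{c_r(S)}\cdot\dfrac{(l_r-s+1+\gamma_r)^{t\uparrow}}{t!}\cdot\gamma_r^{(s-n_r(S)-t)\downarrow}\,(S_{m_r}+t)!\prod_{j=m_{r-1}+1}^{m_r-1}S_j!$. A $\lambda$-tableau $T$ is pseudo-standard if its entries weakly increase along rows and $T^i_j\neq 0$ only if $i=j$ or $\lambda_i<\lambda_j$. A $\lambda$-tableau is nice if, for each $1\le i\le r$, the number of entries greater than $m_i$ in the set of all rows of length $l_i$ (i.e. rows $m_{i-1}+1,\dots,m_i$) is at most $l_i-l_{i+1}$, where $l_{r+1}$ is read as $0$. *)

theory Defs
  imports Complex_Main "HOL-Number_Theory.Cong"
begin

(* Partitions and compositions are lists of natural numbers; part xs i is the i-th part,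
   counted from 1, and 0 beyond the last part (also at the unused index 0). *)

definition part :: "nat list \<Rightarrow> nat \<Rightarrow> nat" where
  "part xs i = (if 1 \<le> i \<and> i \<le> length xs then xs ! (i - 1) else 0)"

(* A filling assigns to (j, c) the entry in row j, column c, both counted from 1.
   Only its values on the cells 1 <= c <= part la j of the diagram are ever used;
   part la 0 = 0, so that row 0 has no cells. *)

type_synonym filling = "nat \<Rightarrow> nat \<Rightarrow> nat"

definition cells :: "nat list \<Rightarrow> (nat \<times> nat) set" where
  "cells la = {(j, c). c \<in> {1..part la j}}"

definition tableau_of_type :: "nat list \<Rightarrow> (nat \<Rightarrow> nat) \<Rightarrow> filling \<Rightarrow> bool" where
  "tableau_of_type la nu T \<longleftrightarrow>
     (\<forall>(j, c)\<in>cells la. T j c \<ge> 1) \<and>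
     (\<forall>i\<ge>1. card {(j, c)\<in>cells la. T j c = i} = nu i)"

(* The number T^i_j of entries equal to i in row j. *)

definition row_count :: "nat list \<Rightarrow> filling \<Rightarrow> nat \<Rightarrow> nat \<Rightarrow> nat" where
  "row_count la T i j = card {c \<in> {1..part la j}. T j c = i}"

(* The number T_h of entries greater than h in row h. *)

definition row_excess :: "nat list \<Rightarrow> filling \<Rightarrow> nat \<Rightarrow> nat" where
  "row_excess la T h = card {c \<in> {1..part la h}. T h c > h}"

definition pseudo_standard :: "nat list \<Rightarrow> filling \<Rightarrow> bool" where
  "pseudo_standard la T \<longleftrightarrow>
     (\<forall>j. mono_on {1..part la j} (T j)) \<and>
     (\<forall>i\<ge>1. \<forall>j\<ge>1. row_count la T i j \<noteq> 0 \<longrightarrow> i = j \<or> part la i < part la j)"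

definition shifted_type :: "nat list \<Rightarrow> nat \<Rightarrow> nat \<Rightarrow> nat \<Rightarrow> nat" where
  "shifted_type mu d t = (part mu)(d := part mu d + t, d + 1 := part mu (d + 1) - t)"

definition falling :: "int \<Rightarrow> nat \<Rightarrow> int" where
  "falling a b = (\<Prod>i<b. a - int i)"

(* The rows common to both partitions: l i repeated m i - m (i - 1) times, for i = 1, ..., r,
   where m 0 = 1. *)

definition middle_parts :: "nat \<Rightarrow> (nat \<Rightarrow> nat) \<Rightarrow> (nat \<Rightarrow> nat) \<Rightarrow> nat list" where
  "middle_parts r m l = concat (map (\<lambda>i. replicate (m i - m (i - 1)) (l i)) [1..<Suc r])"

definition lam :: "nat \<Rightarrow> nat \<Rightarrow> (nat \<Rightarrow> nat) \<Rightarrow> (nat \<Rightarrow> nat) \<Rightarrow> nat list" where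
  "lam r s m l = (l 0 + s) # middle_parts r m l"

definition mu :: "nat \<Rightarrow> nat \<Rightarrow> (nat \<Rightarrow> nat) \<Rightarrow> (nat \<Rightarrow> nat) \<Rightarrow> nat list" where
  "mu r s m l = l 0 # middle_parts r m l @ [s]"

(* The truncated subtraction is harmless: l is strictly decreasing on {1..r}. *)

definition nice :: "nat \<Rightarrow> nat \<Rightarrow> (nat \<Rightarrow> nat) \<Rightarrow> (nat \<Rightarrow> nat) \<Rightarrow> filling \<Rightarrow> bool" where
  "nice r s m l T \<longleftrightarrow>
     (\<forall>i\<in>{1..r}.
        card {(j, c)\<in>cells (lam r s m l). j \<in> {m (i - 1)<..m i} \<and> T j c > m i}
          \<le> l i - (if i = r then 0 else l (i + 1)))"

definition n_fun :: "nat \<Rightarrow> nat \<Rightarrow> (nat \<Rightarrow> nat) \<Rightarrow> (nat \<Rightarrow> nat) \<Rightarrow> nat \<Rightarrow> filling \<Rightarrow> nat" where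
  "n_fun r s m l i T = (\<Sum>h\<in>{m (i - 1)<..m i}. row_excess (lam r s m l) T h)"

(* In a pseudo-standard tableau of type mu or shifted_type mu (m b) t, the rows up to m i contain
   every entry up to m i, hence exactly s entries exceeding m i, or s - t of them if i = b.
   For i >= 1 this bounds n_fun, so the natural-number subtractions s - n_fun and s - n_fun - t
   in c_fun and g_fun below are not truncated there. *)

definition c_fun ::
  "nat \<Rightarrow> nat \<Rightarrow> (nat \<Rightarrow> nat) \<Rightarrow> (nat \<Rightarrow> nat) \<Rightarrow> (nat \<Rightarrow> int) \<Rightarrow> nat \<Rightarrow> filling \<Rightarrow> int" where
  "c_fun r s m l \<gamma> i T =
     falling (\<gamma> i) (s - n_fun r s m l i T) *
     (\<Prod>h\<in>{m (i - 1)<..m i}. fact (row_excess (lam r s m l) T h))"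

definition f_fun ::
  "nat \<Rightarrow> nat \<Rightarrow> (nat \<Rightarrow> nat) \<Rightarrow> (nat \<Rightarrow> nat) \<Rightarrow> (nat \<Rightarrow> int) \<Rightarrow> filling \<Rightarrow> int" where
  "f_fun r s m l \<gamma> T = (\<Prod>i\<in>{1..r}. c_fun r s m l \<gamma> i T)"

(* pochhammer a t is the rising factorial; its division by fact t is exact
   by fact_dvd_pochhammer. *)

definition g_fun ::
  "nat \<Rightarrow> nat \<Rightarrow> (nat \<Rightarrow> nat) \<Rightarrow> (nat \<Rightarrow> nat) \<Rightarrow> (nat \<Rightarrow> int) \<Rightarrow> nat \<Rightarrow> nat \<Rightarrow> filling \<Rightarrow> int" where
  "g_fun r s m l \<gamma> b t S =
    (if b = 0 then
       f_fun r s m l \<gamma> S *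
       (pochhammer (int (l 0) - int (l 1) + int (m 1) - 1 + int s - \<gamma> 1) t div fact t)
     else
       (\<Prod>i\<in>{1..r} - {b}. c_fun r s m l \<gamma> i S) *
       (pochhammer
          (if b < r
           then int (l b) - int (l (b + 1)) + int (m (b + 1)) - int (m b) + \<gamma> b - \<gamma> (b + 1)
           else int (l r) - int s + 1 + \<gamma> r) t div fact t) *
       falling (\<gamma> b) (s - n_fun r s m l b S - t) *
       fact (row_excess (lam r s m l) S (m b) + t) *
       (\<Prod>j\<in>{m (b - 1)<..<m b}. fact (row_excess (lam r s m l) S j)))"

end

theory Submission
  imports Defs "HOL-Library.Disjoint_Sets" "HOL-Combinatorics.Transposition"
begin

text \<open>A pseudo-standard tableau of type \<open>\<mu>\<close> amounts to a flow of \<open>s\<close> units from row 1 to the missing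
  row \<open>m r + 1\<close>, an entry \<open>k\<close> in row \<open>j\<close> being a unit that steps from \<open>j\<close> to \<open>k\<close>; \<open>f\<close> depends only on
  the throughputs of the rows. Given \<open>b\<close>, the flow can be rearranged, without losing that \<open>f\<close> is not
  divisible by \<open>p ^ e\<close>, so that some unit steps from \<open>m b\<close> to \<open>m b + 1\<close>. Replacing that entry \<open>m b + 1\<close>
  of row \<open>m b\<close> by \<open>m b\<close> gives a tableau \<open>S\<close> of type \<open>\<nu>(\<mu>, m b, 1)\<close> for which \<open>g S\<close> is \<open>f\<close> times the base of
  the rising factorial in \<open>g\<close>, so \<open>p\<close> divides this base. The congruences for \<open>b = 0, \<dots>, r\<close> telescope
  to the claim.\<close>

section \<open>Fillings and their row counts\<close>

lemma finite_cells: "finite (cells la)"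
proof -
  have "cells la = Sigma {1..length la} (\<lambda>j. {1..part la j})"
    by (auto simp: cells_def part_def split: if_splits)
  then show ?thesis by simp
qed

lemma card_cells_eq_sum:
  "card {(j, c)\<in>cells la. P j (T j c)} = (\<Sum>j\<in>{1..length la}. card {c\<in>{1..part la j}. P j (T j c)})"
proof -
  have "{(j, c)\<in>cells la. P j (T j c)} = Sigma {1..length la} (\<lambda>j. {c\<in>{1..part la j}. P j (T j c)})"
    by (auto simp: cells_def part_def split: if_splits)
  then show ?thesis by simp
qed

text \<open>Row \<open>j\<close> is read off the sorted word with \<open>N j k\<close> copies of
  each letter \<open>k\<close>; columns start at 1 and list positions at 0. The predicate
  \<open>P\<close> is left general so that one statement yields both the number of entries equal to
  \<open>k\<close> and the excess of a row.\<close>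

lemma filling_with_row_counts:
  assumes "\<And>j. 1 \<le> j \<Longrightarrow> j \<le> length la \<Longrightarrow> (\<Sum>k\<in>{1..M}. N j k) = part la j"
  obtains T :: filling where
    "\<And>j. mono_on {1..part la j} (T j)"
    "\<And>j P. 1 \<le> j \<Longrightarrow> j \<le> length la \<Longrightarrow>
       card {c\<in>{1..part la j}. P (T j c)} = (\<Sum>k\<in>{1..M}. if P k then N j k else 0)"
    "\<And>j c. (j, c) \<in> cells la \<Longrightarrow> T j c \<in> {1..M}"
proof
  define xs where "xs j = concat (map (\<lambda>k. replicate (N j k) k) [1..<Suc M])" for j
  define T where "T j c = xs j ! (c - 1)" for j c
  have len_filter: "length (filter P (concat (map (\<lambda>k. replicate (N j k) k) [1..<Suc M']))) =
      (\<Sum>k\<in>{1..M'}. if P k then N j k else 0)" for P j M'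
    by (induction M') (auto simp: filter_replicate)
  have len: "length (xs j) = part la j" if "1 \<le> j" "j \<le> length la" for j
    using len_filter[of "\<lambda>_. True" j M] assms[OF that] by (simp add: xs_def)
  have sorted: "sorted (xs j)" for j
  proof -
    have "sorted (concat (map (\<lambda>k. replicate (N j k) k) [1..<Suc M']))" for M'
      by (induction M') (auto simp: sorted_append)
    then show ?thesis by (simp add: xs_def)
  qed
  show "mono_on {1..part la j} (T j)" for j
  proof (cases "1 \<le> j \<and> j \<le> length la")
    case True
    then show ?thesis
      using sorted[of j] len[of j] by (auto simp: mono_on_def T_def intro!: sorted_nth_mono)
  qed (auto simp: part_def mono_on_def)
  show "card {c\<in>{1..part la j}. P (T j c)} = (\<Sum>k\<in>{1..M}. if P k then N j k else 0)"
    if "1 \<le> j" "j \<le> length la" for j P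
  proof -
    have "{c\<in>{1..part la j}. P (T j c)} = Suc ` {i. i < length (xs j) \<and> P (xs j ! i)}"
    proof -
      have "c \<in> Suc ` {i. i < length (xs j) \<and> P (xs j ! i)}"
        if "1 \<le> c" "c \<le> part la j" "P (T j c)" for c
        using that len[OF \<open>1 \<le> j\<close> \<open>j \<le> length la\<close>]
        by (intro image_eqI[of _ _ "c - 1"]) (auto simp: T_def)
      then show ?thesis using len[OF that] by (auto simp: T_def)
    qed
    then show ?thesis
      using len_filter[of P j M] by (simp add: xs_def card_image length_filter_conv_card)
  qed
  show "T j c \<in> {1..M}" if "(j, c) \<in> cells la" for j c
  proof -
    have "1 \<le> j" "j \<le> length la" "1 \<le> c" "c \<le> part la j"
      using that by (auto simp: cells_def part_def split: if_splits)
    then have "T j c \<in> set (xs j)" using len[of j] by (auto simp: T_def)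
    also have "set (xs j) \<subseteq> {1..M}" by (auto simp: xs_def)
    finally show ?thesis .
  qed
qed

section \<open>Choosing the paths through one block\<close>

text \<open>The sets are chosen greedily, each from what its predecessors left over. This turns
  numerical throughputs of rows into actual sets of paths.\<close>

lemma disjoint_subsets_with_cards:
  fixes E :: "'b \<Rightarrow> nat"
  assumes "finite B" "finite A" "(\<Sum>h\<in>B. E h) \<le> card A"
  shows "\<exists>U. disjoint_family_on U B \<and> (\<forall>h\<in>B. U h \<subseteq> A \<and> card (U h) = E h)"
  using assms
proof (induction B arbitrary: A rule: finite_induct)
  case empty
  then show ?case by (auto simp: disjoint_family_on_def)
next
  case (insert x B)
  then have "E x \<le> card A" by simp
  then obtain X where X: "X \<subseteq> A" "card X = E x" "finite X"
    by (meson obtain_subset_with_card_n)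
  have "(\<Sum>h\<in>B. E h) \<le> card (A - X)"
    using insert X by (simp add: card_Diff_subset)
  then obtain U where U: "disjoint_family_on U B" "\<forall>h\<in>B. U h \<subseteq> A - X \<and> card (U h) = E h"
    using insert.IH[of "A - X"] insert.prems by auto
  have "disjoint_family_on (U(x := X)) (insert x B)"
    using U insert.hyps by (auto simp: disjoint_family_on_def)
  then show ?case
  proof (intro exI conjI)
    show "\<forall>h\<in>insert x B. (U(x := X)) h \<subseteq> A \<and> card ((U(x := X)) h) = E h"
      using U X insert.hyps by auto
  qed
qed

lemma falling_Suc: "falling a (Suc n) = falling a n * (a - int n)"
  by (simp add: falling_def)

text \<open>If the block is visited, permute its rows; otherwise raising the excess of row \<open>d\<close> from 0 to 1
  turns \<open>falling \<gamma> s\<close> into its divisor \<open>falling \<gamma> (s - 1)\<close>.\<close>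

lemma block_excess_dvd:
  fixes E :: "nat \<Rightarrow> nat" and \<gamma> :: int
  assumes "finite B" "d \<in> B" "(\<Sum>h\<in>B. E h) \<le> s" "s \<ge> 1"
  obtains E' where "E' d \<ge> 1" "(\<Sum>h\<in>B. E' h) \<le> s"
    "falling \<gamma> (s - (\<Sum>h\<in>B. E' h)) * (\<Prod>h\<in>B. fact (E' h)) dvd
     falling \<gamma> (s - (\<Sum>h\<in>B. E h)) * (\<Prod>h\<in>B. fact (E h))"
proof (cases "\<exists>h\<in>B. E h \<noteq> 0")
  case True
  then obtain h where h: "h \<in> B" "E h \<noteq> 0" by blast
  define \<pi> where "\<pi> = transpose h d"
  have bij: "bij_betw \<pi> B B"
    unfolding \<pi>_def using h assms by (simp add: bij_betw_transpose_iff)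
  have "(\<Sum>h\<in>B. E (\<pi> h)) = (\<Sum>h\<in>B. E h)"
    by (rule sum.reindex_bij_betw[OF bij])
  moreover have "(\<Prod>h\<in>B. fact (E (\<pi> h))) = (\<Prod>h\<in>B. fact (E h) :: int)"
    by (rule prod.reindex_bij_betw[OF bij])
  moreover have "E (\<pi> d) \<ge> 1" using h by (simp add: \<pi>_def)
  ultimately show ?thesis
    using assms(3) by (intro that[of "E \<circ> \<pi>"]) simp_all
next
  case False
  define E' :: "nat \<Rightarrow> nat" where "E' h = (if h = d then 1 else 0)" for h
  have sum: "(\<Sum>h\<in>B. E' h) = 1" using assms by (simp add: E'_def)
  have prod: "(\<Prod>h\<in>B. fact (E' h)) = (1::int)" by (rule prod.neutral) (simp add: E'_def)
  obtain s' where s': "s = Suc s'" using \<open>s \<ge> 1\<close> by (cases s) auto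
  show ?thesis
  proof (rule that[of E'])
    show "E' d \<ge> 1" by (simp add: E'_def)
    show "(\<Sum>h\<in>B. E' h) \<le> s" using sum assms(4) by simp
    show "falling \<gamma> (s - (\<Sum>h\<in>B. E' h)) * (\<Prod>h\<in>B. fact (E' h)) dvd
      falling \<gamma> (s - (\<Sum>h\<in>B. E h)) * (\<Prod>h\<in>B. fact (E h))"
      using False unfolding sum prod by (simp add: s' falling_Suc)
  qed
qed

text \<open>The improved throughputs of \<open>block_excess_dvd\<close> are realised by disjoint
  sets of paths. Row \<open>d\<close> is visited by some path \<open>v\<close>, and exchanging the
  labels \<open>v\<close> and 0 makes it path 0 without changing any cardinality. A fixed label lets
  the choices in different blocks fit together later.\<close>

lemma block_paths:
  fixes E :: "nat \<Rightarrow> nat" and \<gamma> :: int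
  assumes "finite B" "d \<in> B" "(\<Sum>h\<in>B. E h) \<le> s" "s \<ge> 1"
  shows "\<exists>U. disjoint_family_on U B \<and> (\<forall>h\<in>B. U h \<subseteq> {..<s}) \<and> 0 \<in> U d \<and>
    (\<Sum>h\<in>B. card (U h)) \<le> s \<and>
    falling \<gamma> (s - (\<Sum>h\<in>B. card (U h))) * (\<Prod>h\<in>B. fact (card (U h))) dvd
    falling \<gamma> (s - (\<Sum>h\<in>B. E h)) * (\<Prod>h\<in>B. fact (E h))"
proof -
  obtain E' where E': "E' d \<ge> 1" "(\<Sum>h\<in>B. E' h) \<le> s"
    "falling \<gamma> (s - (\<Sum>h\<in>B. E' h)) * (\<Prod>h\<in>B. fact (E' h)) dvd
     falling \<gamma> (s - (\<Sum>h\<in>B. E h)) * (\<Prod>h\<in>B. fact (E h))"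
    using block_excess_dvd[OF assms] .
  obtain U where U: "disjoint_family_on U B" "\<forall>h\<in>B. U h \<subseteq> {..<s} \<and> card (U h) = E' h"
    using disjoint_subsets_with_cards[of B "{..<s}" E'] assms(1) E'(2) by auto
  have "U d \<noteq> {}" using U(2) assms(2) E'(1) by force
  then obtain v where v: "v \<in> U d" by blast
  define V where "V h = transpose v 0 ` U h" for h
  have "v < s" using v U(2) assms(2) by blast
  have inj: "inj (transpose v (0::nat))" by simp
  have card: "card (V h) = E' h" if "h \<in> B" for h
    using U(2) that by (simp add: V_def card_image inj_on_subset[OF inj])
  have "disjoint_family_on V B"
    using U(1) by (auto simp: disjoint_family_on_def V_def simp flip: image_Int[OF inj])
  moreover have "V h \<subseteq> {..<s}" if "h \<in> B" for h
  proof -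
    have "U h \<subseteq> {..<s}" using U(2) that by blast
    then show ?thesis using \<open>v < s\<close> by (auto simp: V_def transpose_def)
  qed
  moreover have "0 \<in> V d" using v by (force simp: V_def)
  ultimately show ?thesis
    using E'(2,3) card by (intro exI[of _ V]) simp
qed

section \<open>Blocks of equal rows and the row lengths of the partition\<close>

locale block_partition =
  fixes r s :: nat and m l :: "nat \<Rightarrow> nat"
  assumes r: "r \<ge> 1" and s: "s \<ge> 1" and m0: "m 0 = 1"
    and m_Suc: "\<And>i. i < r \<Longrightarrow> m i < m (i + 1)"
    and l0: "l 0 \<ge> l 1"
    and l_Suc: "\<And>i. 1 \<le> i \<Longrightarrow> i < r \<Longrightarrow> l i > l (i + 1)"
    and lr: "l r \<ge> s"
begin

abbreviation "L \<equiv> part (lam r s m l)"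
abbreviation "block i \<equiv> {m (i - 1)<..m i}"

lemma m_less: "i < j \<Longrightarrow> j \<le> r \<Longrightarrow> m i < m j"
proof (induction j)
  case (Suc j)
  then show ?case using m_Suc[of j] by (cases "i = j") auto
qed simp

lemma m_le: "i \<le> j \<Longrightarrow> j \<le> r \<Longrightarrow> m i \<le> m j"
  using m_less[of i j] by (cases "i = j") auto

lemma m_ge_1: "i \<le> r \<Longrightarrow> 1 \<le> m i"
  using m_le[of 0 i] m0 by simp

lemma m_pred_ge_1: "i \<in> {1..r} \<Longrightarrow> 1 \<le> m (i - 1)"
  by (rule m_ge_1) auto

lemma l_less: "1 \<le> i \<Longrightarrow> i < j \<Longrightarrow> j \<le> r \<Longrightarrow> l j < l i"
proof (induction j)
  case (Suc j)
  then show ?case using l_Suc[of j] by (cases "i = j") auto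
qed simp

lemma l_le: "1 \<le> i \<Longrightarrow> i \<le> j \<Longrightarrow> j \<le> r \<Longrightarrow> l j \<le> l i"
  using l_less[of i j] by (cases "i = j") auto

lemma l_ge_s: "1 \<le> i \<Longrightarrow> i \<le> r \<Longrightarrow> s \<le> l i"
  using l_le[of i r] lr by auto

lemma block_exists:
  assumes "1 < j" "j \<le> m r"
  obtains i where "1 \<le> i" "i \<le> r" "j \<in> block i"
proof -
  define i where "i = (LEAST i. j \<le> m i)"
  have "j \<le> m i" unfolding i_def by (rule LeastI[of _ r]) (rule assms)
  moreover have "i \<le> r" unfolding i_def by (rule Least_le) (rule assms)
  moreover have "i \<noteq> 0" using \<open>j \<le> m i\<close> m0 assms by (cases i) auto
  moreover have "\<not> j \<le> m (i - 1)"
    unfolding i_def by (rule not_less_Least) (use \<open>i \<noteq> 0\<close> in \<open>simp add: i_def\<close>)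
  ultimately show ?thesis by (intro that[of i]) auto
qed

lemma block_unique:
  assumes "i \<in> {1..r}" "i' \<in> {1..r}" "j \<in> block i" "j \<in> block i'"
  shows "i = i'"
proof (rule ccontr)
  assume "i \<noteq> i'"
  then consider "i \<le> i' - 1" | "i' \<le> i - 1" by linarith
  then show False
  proof cases
    case 1
    then have "m i \<le> m (i' - 1)" using assms(2) by (intro m_le) auto
    then show False using assms(3,4) by auto
  next
    case 2
    then have "m i' \<le> m (i - 1)" using assms(1) by (intro m_le) auto
    then show False using assms(3,4) by auto
  qed
qed

lemma block_subset: "i \<in> {1..r} \<Longrightarrow> block i \<subseteq> {2..m r}"
  using m_pred_ge_1[of i] m_le[of i r] by auto

text \<open>The number \<open>q\<close> of blocks is free for the induction, since each further
  block is appended on the right. Row \<open>j\<close> sits at position \<open>j - 2\<close>: one is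
  lost to the first row, one to counting from 0.\<close>

lemma middle_parts_facts:
  "q \<le> r \<Longrightarrow> length (middle_parts q m l) = m q - 1 \<and>
    (\<forall>i\<in>{1..q}. \<forall>j\<in>block i. middle_parts q m l ! (j - 2) = l i)"
proof (induction q)
  case 0
  then show ?case by (simp add: middle_parts_def m0)
next
  case (Suc q)
  have split: "middle_parts (Suc q) m l = middle_parts q m l @ replicate (m (Suc q) - m q) (l (Suc q))"
    by (simp add: middle_parts_def)
  have IH: "length (middle_parts q m l) = m q - 1"
    "\<And>i j. i \<in> {1..q} \<Longrightarrow> j \<in> block i \<Longrightarrow> middle_parts q m l ! (j - 2) = l i"
    using Suc by auto
  have q: "1 \<le> m q" "m q < m (Suc q)" using m_ge_1[of q] m_less[of q "Suc q"] Suc.prems by auto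
  have "middle_parts (Suc q) m l ! (j - 2) = l i" if "i \<in> {1..Suc q}" "j \<in> block i" for i j
  proof (cases "i = Suc q")
    case True
    then show ?thesis using that q IH(1) by (auto simp: split nth_append)
  next
    case False
    then have i: "i \<in> {1..q}" using that by auto
    then have "j \<le> m q" "1 < j"
      using i that m_le[of i q] m_pred_ge_1[of i] Suc.prems by auto
    then show ?thesis using IH(2)[OF i that(2)] IH(1) by (auto simp: split nth_append)
  qed
  then show ?case using IH(1) q by (auto simp: split)
qed

lemma length_lam: "length (lam r s m l) = m r"
  using middle_parts_facts[of r] m_ge_1[of r] by (simp add: lam_def)

lemma L_1: "L 1 = l 0 + s"
  by (simp add: part_def lam_def)

lemma L_beyond: "j > m r \<Longrightarrow> L j = 0"
  by (simp add: part_def length_lam)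

lemma L_block:
  assumes "i \<in> {1..r}" "j \<in> block i" shows "L j = l i"
proof -
  have "2 \<le> j" "j \<le> m r" using assms block_subset[of i] by auto
  moreover from this have "lam r s m l ! (j - 1) = middle_parts r m l ! (j - 2)"
    by (simp add: lam_def nth_Cons' numeral_2_eq_2)
  ultimately show ?thesis
    using assms middle_parts_facts[of r] by (simp add: part_def length_lam)
qed

lemma part_mu:
  "part (mu r s m l) j = (if j = 1 then l 0 else if j = m r + 1 then s else L j)"
proof -
  have len: "length (middle_parts r m l) = m r - 1" "1 \<le> m r" "1 < m r"
    using middle_parts_facts[of r] m_ge_1[of r] m_less[of 0 r] m0 r by auto
  then show ?thesis
    by (auto simp: part_def mu_def lam_def nth_append nth_Cons')
qed

lemma L_ge_s: "1 \<le> j \<Longrightarrow> j \<le> m r \<Longrightarrow> s \<le> L j"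
proof (cases "j = 1")
  case False
  assume "1 \<le> j" "j \<le> m r"
  with False obtain i where i: "1 \<le> i" "i \<le> r" "j \<in> block i" using block_exists[of j] by auto
  then show ?thesis using L_block[of i j] l_ge_s[of i] by auto
qed (use L_1 in auto)

text \<open>The block boundary \<open>m i\<close> separates the two rows. A row below the diagram
  has length 0, less than \<open>s\<close>; row 1 exceeds every other row because
  \<open>l 0 + s > l 1\<close>; two remaining rows lie in different blocks, where \<open>l\<close>
  strictly decreases.\<close>

lemma L_less:
  assumes "i \<le> r" "1 \<le> j" "j \<le> m i" "m i < k"
  shows "L k < L j"
proof (cases "k > m r")
  case True
  then show ?thesis using L_beyond[of k] L_ge_s[of j] assms m_le[of i r] s by auto
next
  case False
  have "1 < k" using assms by auto
  with False obtain i' where i': "1 \<le> i'" "i' \<le> r" "k \<in> block i'"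
    using block_exists[of k] by auto
  have Lk: "L k = l i'" using i' L_block by auto
  show ?thesis
  proof (cases "j = 1")
    case True
    then show ?thesis using Lk L_1 l_le[of 1 i'] i' l0 s by auto
  next
    case j: False
    have "j \<le> m r" using assms m_le[of i r] by auto
    with j obtain i'' where i'': "1 \<le> i''" "i'' \<le> r" "j \<in> block i''"
      using block_exists[of j] assms by auto
    have "i'' < i'"
    proof (rule ccontr)
      assume "\<not> i'' < i'"
      consider "i' \<le> i" | "i < i'" by linarith
      then show False
      proof cases
        case 1
        then show False using m_le[of i' i] i' assms by auto
      next
        case 2
        then have "m i \<le> m (i'' - 1)" using \<open>\<not> i'' < i'\<close> i'' by (intro m_le) auto
        then show False using i'' assms by auto
      qed
    qed
    then show ?thesis using Lk L_block[of i'' j] l_less[of i'' i'] i' i'' by auto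
  qed
qed

text \<open>This translates the length condition of pseudo-standardness into one on indices: a row
  of block \<open>i\<close> may hold, apart from its own index, only values beyond the end of that
  block.\<close>

lemma L_less_block_iff:
  assumes "i \<in> {1..r}" "j \<in> block i" "1 \<le> k"
  shows "L k < L j \<longleftrightarrow> m i < k"
proof
  assume less: "L k < L j"
  show "m i < k"
  proof (rule ccontr)
    assume "\<not> m i < k"
    moreover have "\<not> k \<le> m (i - 1)"
    proof
      assume "k \<le> m (i - 1)"
      then have "L j < L k" using assms by (intro L_less[of "i - 1"]) auto
      then show False using less by simp
    qed
    ultimately show False using assms less L_block[of i j] L_block[of i k] by auto
  qed
next
  assume "m i < k"
  then show "L k < L j" using assms L_less[of i j k] by auto
qed

lemma L_antimono: "1 \<le> j \<Longrightarrow> j \<le> k \<Longrightarrow> L k \<le> L j"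
proof (rule ccontr)
  assume jk: "1 \<le> j" "j \<le> k" "\<not> L k \<le> L j"
  then have "k \<le> m r" using L_beyond[of k] by (cases "k \<le> m r") auto
  moreover have "1 < k" using jk by (cases "k = 1") auto
  ultimately obtain i where i: "1 \<le> i" "i \<le> r" "k \<in> block i" using block_exists[of k] by auto
  then show False using L_less_block_iff[of i k j] jk by auto
qed

section \<open>At most \<open>s\<close> units pass through a block\<close>

lemma entry_le_row:
  assumes "pseudo_standard (lam r s m l) T" "(j, c) \<in> cells (lam r s m l)" "T j c \<ge> 1"
  shows "j = T j c \<or> L (T j c) < L j"
proof -
  have "j \<ge> 1" "c \<in> {1..L j}" using assms(2) by (auto simp: cells_def part_def split: if_splits)
  then have "row_count (lam r s m l) T (T j c) j \<noteq> 0" by (auto simp: row_count_def)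
  then show ?thesis using assms(1,3) \<open>j \<ge> 1\<close> unfolding pseudo_standard_def by metis
qed

text \<open>All entries up to \<open>m i\<close> lie in the first \<open>m i\<close> rows, which
  have exactly \<open>s\<close> more cells than \<open>mu\<close> supplies such entries. Hence
  exactly \<open>s\<close> entries of these rows exceed \<open>m i\<close>, and the excesses in
  block \<open>i\<close> are among them.\<close>

lemma block_excess_le:
  assumes T: "tableau_of_type (lam r s m l) (part (mu r s m l)) T" "pseudo_standard (lam r s m l) T"
    and i: "i \<in> {1..r}"
  shows "n_fun r s m l i T \<le> s"
proof -
  let ?la = "lam r s m l"
  have pos: "T j c \<ge> 1" if "(j, c) \<in> cells ?la" for j c
    using T(1) that by (auto simp: tableau_of_type_def)
  have im: "m i \<le> m r" "1 \<le> m i" using i m_le[of i r] m_ge_1[of i] by auto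
  define lo where "lo j = card {c\<in>{1..L j}. T j c \<le> m i}" for j
  define hi where "hi j = card {c\<in>{1..L j}. T j c > m i}" for j
  have lo_hi: "lo j + hi j = L j" for j
  proof -
    have "lo j + hi j = card ({c\<in>{1..L j}. T j c \<le> m i} \<union> {c\<in>{1..L j}. T j c > m i})"
      unfolding lo_def hi_def by (rule card_Un_disjoint[symmetric]) auto
    also have "{c\<in>{1..L j}. T j c \<le> m i} \<union> {c\<in>{1..L j}. T j c > m i} = {1..L j}" by auto
    finally show ?thesis by simp
  qed
  have "n_fun r s m l i T = (\<Sum>h\<in>block i. hi h)"
    unfolding n_fun_def
  proof (rule sum.cong)
    fix h assume h: "h \<in> block i"
    \<comment> \<open>An entry of row \<open>h\<close> other than \<open>h\<close> names a shorter
      row, and all shorter rows lie beyond the block.\<close>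
    have "T h c > h \<longleftrightarrow> T h c > m i" if c: "c \<in> {1..L h}" for c
    proof -
      have hc: "(h, c) \<in> cells ?la" using c by (simp add: cells_def)
      show ?thesis
        using entry_le_row[OF T(2) hc pos[OF hc]] L_less_block_iff[OF i h pos[OF hc]] h by auto
    qed
    then have "{c \<in> {1..L h}. T h c > h} = {c\<in>{1..L h}. T h c > m i}" by blast
    then show "row_excess ?la T h = hi h" by (simp add: row_excess_def hi_def)
  qed simp
  also have "\<dots> \<le> (\<Sum>h\<in>{1..m i}. hi h)" by (rule sum_mono2) auto
  finally have n_le: "n_fun r s m l i T \<le> (\<Sum>h\<in>{1..m i}. hi h)" .
  have "(\<Sum>k\<in>{1..m i}. part (mu r s m l) k) = (\<Sum>k\<in>{1..m i}. card {(j, c)\<in>cells ?la. T j c = k})"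
    using T(1) by (simp add: tableau_of_type_def)
  also have "\<dots> = card (\<Union>k\<in>{1..m i}. {(j, c)\<in>cells ?la. T j c = k})"
    by (rule card_UN_disjoint[symmetric]) (auto intro: finite_subset[OF _ finite_cells[of ?la]])
  \<comment> \<open>An entry at most \<open>m i\<close> below row \<open>m i\<close> would be
    smaller than its row index and would have to name a strictly shorter row, although row lengths
    weakly decrease.\<close>
  also have "(\<Union>k\<in>{1..m i}. {(j, c)\<in>cells ?la. T j c = k}) =
      Sigma {1..m i} (\<lambda>j. {c\<in>{1..L j}. T j c \<le> m i})"
  proof (intro equalityI subsetI; clarsimp)
    fix j c assume jc: "(j, c) \<in> cells ?la" "T j c \<le> m i"
    have "j \<ge> 1" using jc(1) by (auto simp: cells_def part_def split: if_splits)
    moreover have "j \<le> m i"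
    proof (rule ccontr)
      assume "\<not> j \<le> m i"
      then have "T j c < j" using jc(2) by simp
      then show False
        using entry_le_row[OF T(2) jc(1) pos[OF jc(1)]] L_antimono[OF pos[OF jc(1)], of j] by simp
    qed
    ultimately show "Suc 0 \<le> j \<and> j \<le> m i \<and> Suc 0 \<le> c \<and> c \<le> L j"
      using jc(1) by (simp add: cells_def)
  next
    fix j c assume "Suc 0 \<le> c" "c \<le> L j" "Suc 0 \<le> j" "j \<le> m i" "T j c \<le> m i"
    then show "(j, c) \<in> cells ?la \<and> Suc 0 \<le> T j c"
      using pos[of j c] by (simp add: cells_def)
  qed
  also have "card \<dots> = (\<Sum>j\<in>{1..m i}. lo j)" by (simp add: lo_def)
  finally have lo_sum: "(\<Sum>k\<in>{1..m i}. part (mu r s m l) k) = (\<Sum>j\<in>{1..m i}. lo j)" .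
  have "(\<Sum>j\<in>{1..m i}. lo j) + (\<Sum>j\<in>{1..m i}. hi j) = (\<Sum>j\<in>{1..m i}. L j)"
    by (simp add: lo_hi flip: sum.distrib)
  also have "\<dots> = (\<Sum>j\<in>{1..m i}. part (mu r s m l) j + (if j = 1 then s else 0))"
    using im L_1 by (intro sum.cong) (auto simp: part_mu)
  also have "\<dots> = (\<Sum>j\<in>{1..m i}. part (mu r s m l) j) + s"
    using im by (simp add: sum.distrib)
  finally show ?thesis using n_le lo_sum by simp
qed

section \<open>From systems of paths to tableaux\<close>

text \<open>The set \<open>U h\<close> consists of the paths, out of \<open>s\<close> in total, that visit row \<open>h\<close>; a step from \<open>j\<close> to \<open>k\<close>
  puts an entry \<open>k\<close> into row \<open>j\<close>. Cutting the step of path 0 from \<open>m b\<close> to \<open>m b + 1\<close> changes the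
  type from \<open>\<mu>\<close> to \<open>\<nu>(\<mu>, m b, 1)\<close>.\<close>

lemma tableau_of_paths:
  assumes sub: "\<And>h. U h \<subseteq> {..<s}" and U1: "U 1 = {..<s}" and Ulast: "U (m r + 1) = {..<s}"
    and disj: "\<And>i. i \<in> {1..r} \<Longrightarrow> disjoint_family_on U (block i)"
    and b: "b \<le> r" "0 \<in> U (m b)" "0 \<in> U (m b + 1)"
  obtains S where
    "tableau_of_type (lam r s m l) (shifted_type (mu r s m l) (m b) 1) S"
    "pseudo_standard (lam r s m l) S"
    "\<And>h. h \<in> {1..m r} \<Longrightarrow> row_excess (lam r s m l) S h = card (U h - (if h = m b then {0} else {}))"
proof -
  let ?M = "m r + 1" and ?la = "lam r s m l"
  \<comment> \<open>\<open>O' j\<close> are the paths that still leave row \<open>j\<close> and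
    \<open>I k\<close> those that still enter row \<open>k\<close>: path 0 is dropped at both ends
    of the cut step. \<open>W j k\<close> consists of the paths whose next row after
    \<open>j\<close> is \<open>k\<close>, and the remaining cells of row \<open>j\<close> are filled
    with \<open>j\<close>.\<close>
  define O' where "O' j = U j - (if j = m b then {0} else {})" for j
  define I where "I k = U k - (if k = m b + 1 then {0} else {})" for k
  define W where "W j k = {u \<in> O' j \<inter> I k. j < k \<and> (\<forall>x\<in>{j<..<k}. u \<notin> U x)}" for j k
  define N where "N j k = (if j = k then L j - card (O' j) else card (W j k))" for j k
  have fin: "finite (U h)" "finite (O' h)" "finite (I h)" "finite (W h k)" for h k
  proof -
    show "finite (U h)" for h using sub finite_subset by blast
    then show "finite (O' h)" "finite (I h)" "finite (W h k)" by (auto simp: O'_def I_def W_def)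
  qed
  have mb: "1 \<le> m b" "m b \<le> m r" using b m_ge_1 m_le[of b r] by auto
  have row: "(\<Sum>k\<in>{j<..?M}. card (W j k)) = card (O' j)" if j: "1 \<le> j" "j \<le> m r" for j
  proof -
    have "(\<Sum>k\<in>{j<..?M}. card (W j k)) = card (\<Union>k\<in>{j<..?M}. W j k)"
    proof (rule card_UN_disjoint[symmetric])
      show "\<forall>k\<in>{j<..?M}. \<forall>k'\<in>{j<..?M}. k \<noteq> k' \<longrightarrow> W j k \<inter> W j k' = {}"
      proof (intro ballI impI equals0I)
        fix k k' u assume "k \<noteq> k'" and "u \<in> W j k \<inter> W j k'"
        then show False by (cases "k < k'") (auto simp: W_def I_def)
      qed
    qed (use fin in auto)
    also have "(\<Union>k\<in>{j<..?M}. W j k) = O' j"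
    proof (intro equalityI subsetI)
      fix u assume u: "u \<in> O' j"
      \<comment> \<open>The next row on the path; it exists because every path ends in row
        \<open>m r + 1\<close>.\<close>
      define k where "k = (LEAST k. j < k \<and> u \<in> U k)"
      have P: "j < ?M \<and> u \<in> U ?M" using j u sub[of j] Ulast by (auto simp: O'_def)
      have k: "j < k" "u \<in> U k" "k \<le> ?M"
        using LeastI[of "\<lambda>k. j < k \<and> u \<in> U k", OF P] Least_le[of "\<lambda>k. j < k \<and> u \<in> U k", OF P]
        by (auto simp: k_def)
      have between: "u \<notin> U x" if "j < x" "x < k" for x
        using not_less_Least[of x "\<lambda>k. j < k \<and> u \<in> U k"] that by (auto simp: k_def)
      \<comment> \<open>Only path 0 entering \<open>m b + 1\<close> could fail here. Since path 0
        also visits \<open>m b\<close>, it would come from there, but that step was removed from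
        \<open>O'\<close> as well.\<close>
      have "u \<in> I k"
      proof (rule ccontr)
        assume "u \<notin> I k"
        then have "k = m b + 1" "u = 0" using k by (auto simp: I_def split: if_splits)
        moreover from this have "j = m b" using between[of "m b"] b k by (cases "j = m b") auto
        ultimately show False using u by (auto simp: O'_def)
      qed
      then have "u \<in> W j k" using u k between by (auto simp: W_def)
      then show "u \<in> (\<Union>k\<in>{j<..?M}. W j k)" using k by auto
    qed (auto simp: W_def)
    finally show ?thesis .
  qed
  have col: "(\<Sum>j\<in>{1..<k}. card (W j k)) = card (I k)" if k: "2 \<le> k" for k
  proof -
    have "(\<Sum>j\<in>{1..<k}. card (W j k)) = card (\<Union>j\<in>{1..<k}. W j k)"
    proof (rule card_UN_disjoint[symmetric])
      show "\<forall>j\<in>{1..<k}. \<forall>j'\<in>{1..<k}. j \<noteq> j' \<longrightarrow> W j k \<inter> W j' k = {}"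
      proof (intro ballI impI equals0I)
        fix j j' u assume "j \<noteq> j'" "u \<in> W j k \<inter> W j' k"
        then show False by (cases "j < j'") (auto simp: W_def O'_def)
      qed
    qed (use fin in auto)
    also have "(\<Union>j\<in>{1..<k}. W j k) = I k"
    proof (intro equalityI subsetI)
      fix u assume u: "u \<in> I k"
      \<comment> \<open>The earlier rows on the path, among them row 1, where every path starts; the
        last of them is the predecessor of \<open>k\<close>.\<close>
      define X where "X = {j\<in>{1..<k}. u \<in> U j}"
      have "1 \<in> X" using u k sub[of k] U1 by (auto simp: X_def I_def)
      define j where "j = Max X"
      have X: "finite X" by (simp add: X_def)
      have j: "1 \<le> j" "j < k" "u \<in> U j"
        using Max_in[OF X] \<open>1 \<in> X\<close> unfolding j_def[symmetric] by (auto simp: X_def)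
      have between: "u \<notin> U x" if "j < x" "x < k" for x
        using Max_ge[OF X, of x] that j unfolding j_def[symmetric] by (auto simp: X_def)
      have "u \<in> O' j"
      proof (rule ccontr)
        assume "u \<notin> O' j"
        then have "j = m b" "u = 0" using j by (auto simp: O'_def split: if_splits)
        moreover from this have "k = m b + 1" using between[of "m b + 1"] b j by (cases "k = m b + 1") auto
        ultimately show False using u by (auto simp: I_def)
      qed
      then have "u \<in> W j k" using u j between by (auto simp: W_def)
      then show "u \<in> (\<Union>j\<in>{1..<k}. W j k)" using j by auto
    qed (auto simp: W_def)
    finally show ?thesis .
  qed
  have W_empty: "W j k = {}" if "\<not> j < k" for j k using that by (auto simp: W_def)
  \<comment> \<open>This keeps the subtraction in the diagonal entry \<open>N j j\<close> from
    truncating.\<close>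
  have card_O: "card (O' j) \<le> L j" if "1 \<le> j" "j \<le> m r" for j
  proof -
    have "card (O' j) \<le> card {..<s}"
      using sub[of j] by (intro card_mono) (auto simp: O'_def)
    then show ?thesis using L_ge_s[OF that] by simp
  qed
  have above: "(\<Sum>k\<in>{1..?M}. if j < k then N j k else 0) = card (O' j)"
    if j: "1 \<le> j" "j \<le> m r" for j
  proof -
    have "(\<Sum>k\<in>{1..?M}. if j < k then N j k else 0) = (\<Sum>k\<in>{j<..?M}. card (W j k))"
      using j by (intro sum.mono_neutral_cong_right) (auto simp: N_def)
    then show ?thesis using row[OF j] by simp
  qed
  have row_sum: "(\<Sum>k\<in>{1..?M}. N j k) = L j" if j: "1 \<le> j" "j \<le> m r" for j
  proof -
    have "(\<Sum>k\<in>{1..?M}. N j k) = (\<Sum>k\<in>{1..?M}. (if j = k then N j j else 0) + (if j < k then N j k else 0))"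
      using W_empty by (intro sum.cong) (auto simp: N_def)
    also have "\<dots> = N j j + card (O' j)"
      using above[OF j] j by (simp add: sum.distrib)
    finally show ?thesis using card_O[OF j] by (simp add: N_def)
  qed
  have len: "length ?la = m r" by (rule length_lam)
  obtain S where S:
    "\<And>j. mono_on {1..L j} (S j)"
    "\<And>j P. 1 \<le> j \<Longrightarrow> j \<le> m r \<Longrightarrow>
       card {c\<in>{1..L j}. P (S j c)} = (\<Sum>k\<in>{1..?M}. if P k then N j k else 0)"
    "\<And>j c. (j, c) \<in> cells ?la \<Longrightarrow> S j c \<in> {1..?M}"
    using filling_with_row_counts[where la = ?la and M = ?M and N = N, unfolded len] row_sum by blast
  have count: "card {c\<in>{1..L j}. S j c = k} = (if k \<in> {1..?M} then N j k else 0)"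
    if "1 \<le> j" "j \<le> m r" for j k
    using S(2)[OF that, of "\<lambda>x. x = k"] by (simp add: sum.delta)
  have excess: "row_excess ?la S h = card (O' h)" if "h \<in> {1..m r}" for h
    using S(2)[of h "\<lambda>x. x > h"] above[of h] that by (simp add: row_excess_def)
  have type: "card {(j, c)\<in>cells ?la. S j c = k} = shifted_type (mu r s m l) (m b) 1 k"
    if k: "1 \<le> k" for k
  proof -
    have "card {(j, c)\<in>cells ?la. S j c = k} = (\<Sum>j\<in>{1..m r}. if k \<in> {1..?M} then N j k else 0)"
      using card_cells_eq_sum[of ?la "\<lambda>_ x. x = k" S] count by (simp add: len)
    also have "\<dots> = shifted_type (mu r s m l) (m b) 1 k"
    proof (cases "k \<le> ?M")
      case False
      then show ?thesis using mb by (auto simp: shifted_type_def part_mu L_beyond)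
    next
      case True
      \<comment> \<open>A value \<open>k\<close> occurs as the filler of row \<open>k\<close>
        itself, or once for each path entering row \<open>k\<close>.\<close>
      have N_split: "N j k = (if j = k then L k - card (O' k) else 0) + (if j < k then card (W j k) else 0)" for j
        using W_empty by (auto simp: N_def)
      have "(\<Sum>j\<in>{1..m r}. if k \<in> {1..?M} then N j k else 0) = (\<Sum>j\<in>{1..m r}. N j k)"
        using True k by (intro sum.cong) auto
      also have "\<dots> = (if k \<le> m r then L k - card (O' k) else 0) +
          (\<Sum>j\<in>{1..m r}. if j < k then card (W j k) else 0)"
        unfolding N_split sum.distrib using k by (simp add: sum.delta)
      also have "(\<Sum>j\<in>{1..m r}. if j < k then card (W j k) else 0) = (\<Sum>j\<in>{1..<k}. card (W j k))"
        using True by (intro sum.mono_neutral_cong_right) auto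
      finally have eq: "(\<Sum>j\<in>{1..m r}. if k \<in> {1..?M} then N j k else 0) =
          (if k \<le> m r then L k - card (O' k) else 0) + (\<Sum>j\<in>{1..<k}. card (W j k))" .
      have cO: "card (O' k) = (if k = m b then card (U k) - 1 else card (U k))"
        using b fin by (auto simp: O'_def)
      have cI: "card (I k) = (if k = m b + 1 then card (U k) - 1 else card (U k))"
        using b fin by (auto simp: I_def)
      have pos: "card (U k) \<ge> 1" if "k = m b \<or> k = m b + 1"
        using that b fin by (auto simp: Suc_le_eq card_gt_0_iff)
      have st: "shifted_type (mu r s m l) (m b) 1 k =
          (if k = m b + 1 then part (mu r s m l) k - 1
           else if k = m b then part (mu r s m l) k + 1 else part (mu r s m l) k)"
        by (simp add: shifted_type_def)
      \<comment> \<open>Nothing enters row 1 and all \<open>s\<close> paths leave it, so it keeps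
        \<open>l 0\<close> fillers. The value \<open>m r + 1\<close> has no row of its own and only
        receives paths. In between, arrivals and departures cancel. The cut adds 1 at
        \<open>m b\<close> and takes 1 away at \<open>m b + 1\<close>.\<close>
      consider "k = 1" | "2 \<le> k" "k \<le> m r" | "k = ?M" using k True by linarith
      then show ?thesis
      proof cases
        case 1
        have "card (U k) = s" "L k = l 0 + s" "part (mu r s m l) k = l 0"
          using 1 U1 L_1 by (simp_all add: part_mu)
        then show ?thesis unfolding eq st cO using 1 mb s by (cases "m b = 1") simp_all
      next
        case 2
        have "card (U k) \<le> L k"
          using card_mono[OF _ sub[of k]] L_ge_s[of k] 2 by simp
        moreover have "part (mu r s m l) k = L k" using 2 by (simp add: part_mu)
        ultimately show ?thesis
          unfolding eq st cO col[OF 2(1)] cI using pos 2 by auto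
      next
        case 3
        have k2: "2 \<le> k" using 3 mb by simp
        have "card (U k) = s" "part (mu r s m l) k = s"
          using 3 Ulast mb by (simp_all add: part_mu)
        then show ?thesis
          unfolding eq st col[OF k2] cI using 3 mb by (cases "m b = m r") simp_all
      qed
    qed
    finally show ?thesis .
  qed
  \<comment> \<open>A path meets each block at most once, so a step out of row \<open>j\<close>
    leads past the end of its block, hence to a strictly shorter row.\<close>
  have N_support: "j = k \<or> L k < L j" if N: "N j k \<noteq> 0" "1 \<le> j" "j \<le> m r" for j k
  proof (cases "j = k")
    case False
    with that have "card (W j k) \<noteq> 0" by (auto simp: N_def)
    then obtain u where "u \<in> W j k" by fastforce
    then have u: "u \<in> U j" "u \<in> U k" "j < k" by (auto simp: W_def O'_def I_def)
    show ?thesis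
    proof (cases "j = 1")
      case True
      then show ?thesis using u L_less[of 0 j k] m0 by auto
    next
      case j1: False
      then obtain i where i: "1 \<le> i" "i \<le> r" "j \<in> block i"
        using block_exists[of j] N by auto
      have "m i < k"
      proof (rule ccontr)
        assume "\<not> m i < k"
        then have "k \<in> block i" using i u by auto
        moreover have "disjoint_family_on U (block i)" using i by (intro disj) simp
        ultimately have "U j \<inter> U k = {}"
          using disjoint_family_onD i(3) u(3) by (metis less_irrefl)
        then show False using u by blast
      qed
      then show ?thesis using L_less_block_iff[of i j k] i by auto
    qed
  qed simp
  show ?thesis
  proof (rule that[of S])
    show "tableau_of_type ?la (shifted_type (mu r s m l) (m b) 1) S"
      unfolding tableau_of_type_def using S(3) type by auto
    have "i = j \<or> L i < L j" if "row_count ?la S i j \<noteq> 0" "1 \<le> i" "1 \<le> j" for i j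
    proof -
      have "j \<le> m r" using that L_beyond[of j] by (cases "j \<le> m r") (auto simp: row_count_def)
      then show ?thesis
        using N_support[of j i] count[of j i] that by (auto simp: row_count_def split: if_splits)
    qed
    then show "pseudo_standard ?la S" unfolding pseudo_standard_def using S(1) by auto
    show "row_excess ?la S h = card (U h - (if h = m b then {0} else {}))" if "h \<in> {1..m r}" for h
      using excess[OF that] by (simp add: O'_def)
  qed
qed

section \<open>The shifted tableau and the value of \<open>g_fun\<close> on it\<close>

text \<open>The base of the rising factorial in \<open>g_fun\<close>; for \<open>t = 1\<close> the
  quotient of \<open>pochhammer\<close> by \<open>fact\<close> is this base itself.\<close>

definition shift_factor :: "(nat \<Rightarrow> int) \<Rightarrow> nat \<Rightarrow> int" where
  "shift_factor \<gamma> b =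
    (if b = 0 then int (l 0) - int (l 1) + int (m 1) - 1 + int s - \<gamma> 1
     else if b < r
     then int (l b) - int (l (b + 1)) + int (m (b + 1)) - int (m b) + \<gamma> b - \<gamma> (b + 1)
     else int (l r) - int s + 1 + \<gamma> r)"

text \<open>\<open>F\<close> is the product of the block factors of the rerouted flow before the
  cut. Rerouting passes to a divisor in each block. The cut lowers the excess of row
  \<open>m b\<close> by 1, and the corrections by \<open>t\<close> in \<open>g_fun\<close> undo
  exactly this.\<close>

lemma shift_tableau_exists:
  assumes T: "tableau_of_type (lam r s m l) (part (mu r s m l)) T" "pseudo_standard (lam r s m l) T"
    and b: "b \<le> r"
  obtains S F where
    "tableau_of_type (lam r s m l) (shifted_type (mu r s m l) (m b) 1) S"
    "pseudo_standard (lam r s m l) S"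
    "F dvd f_fun r s m l \<gamma> T"
    "g_fun r s m l \<gamma> b 1 S = F * shift_factor \<gamma> b"
proof -
  let ?la = "lam r s m l"
  \<comment> \<open>Path 0 has to visit \<open>m b\<close>, the last row of block \<open>b\<close>,
    and \<open>m b + 1\<close>, the first row of block \<open>b + 1\<close>; the first row serves as
    default in every block other than \<open>b\<close>.\<close>
  define d where "d i = (if i = b then m b else m (i - 1) + 1)" for i
  have d: "d i \<in> block i" if "i \<in> {1..r}" for i
    using that m_less[of "i - 1" i] by (auto simp: d_def)
  define E where "E h = row_excess ?la T h" for h
  define C where "C i H = falling (\<gamma> i) (s - (\<Sum>h\<in>block i. H h)) * (\<Prod>h\<in>block i. fact (H h))"
    for i and H :: "nat \<Rightarrow> nat"
  define P where "P i V \<longleftrightarrow> disjoint_family_on V (block i) \<and> (\<forall>h\<in>block i. V h \<subseteq> {..<s}) \<and>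
      0 \<in> V (d i) \<and> (\<Sum>h\<in>block i. card (V h)) \<le> s \<and> C i (\<lambda>h. card (V h)) dvd C i E"
    for i and V :: "nat \<Rightarrow> nat set"
  have "\<exists>V. P i V" if i: "i \<in> {1..r}" for i
    unfolding P_def C_def
    by (rule block_paths) (use d[OF i] s block_excess_le[OF T i] in \<open>auto simp: n_fun_def E_def\<close>)
  then obtain V where "\<And>i. i \<in> {1..r} \<Longrightarrow> P i (V i)" by metis
  then have V: "\<And>i. i \<in> {1..r} \<Longrightarrow> disjoint_family_on (V i) (block i)"
    "\<And>i h. i \<in> {1..r} \<Longrightarrow> h \<in> block i \<Longrightarrow> V i h \<subseteq> {..<s}"
    "\<And>i. i \<in> {1..r} \<Longrightarrow> 0 \<in> V i (d i)"
    "\<And>i. i \<in> {1..r} \<Longrightarrow> (\<Sum>h\<in>block i. card (V i h)) \<le> s"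
    "\<And>i. i \<in> {1..r} \<Longrightarrow> C i (\<lambda>h. card (V i h)) dvd C i E"
    by (simp_all only: P_def)
  \<comment> \<open>The choices in the single blocks are glued together. Outside
    \<open>{2..m r}\<close> the value is the set of all paths, as the start row 1 and the end row
    \<open>m r + 1\<close> require; this also covers \<open>m b\<close> for \<open>b = 0\<close> and
    \<open>m b + 1\<close> for \<open>b = r\<close>.\<close>
  define U where "U h = (if h \<in> {2..m r} then V (THE i. i \<in> {1..r} \<and> h \<in> block i) h else {..<s})" for h
  have U: "U h = V i h" if "i \<in> {1..r}" "h \<in> block i" for i h
  proof -
    have "(THE i. i \<in> {1..r} \<and> h \<in> block i) = i"
      using that block_unique by (intro the_equality) blast+
    then show ?thesis using that block_subset[of i] by (auto simp: U_def)
  qed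
  have sub: "U h \<subseteq> {..<s}" for h
  proof (cases "h \<in> {2..m r}")
    case True
    then obtain i where "1 \<le> i" "i \<le> r" "h \<in> block i" using block_exists[of h] by auto
    then show ?thesis using U[of i h] V(2)[of i h] by auto
  qed (auto simp: U_def)
  have disj: "disjoint_family_on U (block i)" if "i \<in> {1..r}" for i
    using V(1)[OF that] U[OF that] unfolding disjoint_family_on_def by metis
  have U0: "0 \<in> U (d i)" if "i \<in> {1..r}" for i
    using V(3)[OF that] U[OF that d[OF that]] by simp
  have mb: "0 \<in> U (m b)"
  proof (cases "b = 0")
    case True
    then show ?thesis using s m0 by (simp add: U_def)
  next
    case False
    then show ?thesis using U0[of b] b by (simp add: d_def)
  qed
  have mb1: "0 \<in> U (m b + 1)"
  proof (cases "b = r")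
    case True
    then show ?thesis using s by (simp add: U_def)
  next
    case False
    then show ?thesis using U0[of "b + 1"] b by (simp add: d_def)
  qed
  have fin: "finite (U h)" for h using sub[of h] finite_subset by blast
  obtain S where S:
    "tableau_of_type ?la (shifted_type (mu r s m l) (m b) 1) S"
    "pseudo_standard ?la S"
    "\<And>h. h \<in> {1..m r} \<Longrightarrow> row_excess ?la S h = card (U h - (if h = m b then {0} else {}))"
    using tableau_of_paths[OF sub _ _ disj b mb mb1] by (auto simp: U_def)
  define G where "G h = card (U h)" for h
  have C_cong: "C i (\<lambda>h. card (V i h)) = C i G" if "i \<in> {1..r}" for i
    using U[OF that] by (simp add: C_def G_def)
  have ex: "row_excess ?la S h = (if h = m b then G h - 1 else G h)" if "h \<in> {1..m r}" for h
    using S(3)[OF that] mb fin by (simp add: G_def)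
  have c_other: "c_fun r s m l \<gamma> i S = C i G" if i: "i \<in> {1..r} - {b}" for i
  proof -
    have "row_excess ?la S h = G h" if h: "h \<in> block i" for h
    proof -
      \<comment> \<open>For \<open>b > 0\<close> the row \<open>m b\<close> belongs to block
        \<open>b\<close> alone, and for \<open>b = 0\<close> it is row 1, which lies in no
        block.\<close>
      have "h \<noteq> m b"
      proof
        assume "h = m b"
        moreover have "2 \<le> h" using h block_subset[of i] i by auto
        ultimately have "b \<noteq> 0" using m0 by (cases "b = 0") auto
        then have "h \<in> block b" using \<open>h = m b\<close> m_less[of "b - 1" b] b by auto
        then show False using block_unique[of i b h] h i b \<open>b \<noteq> 0\<close> by auto
      qed
      then show ?thesis using ex[of h] h block_subset[of i] i by auto
    qed
    then show ?thesis by (simp add: c_fun_def n_fun_def C_def)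
  qed
  define F where "F = (\<Prod>i\<in>{1..r}. C i G)"
  have "F dvd f_fun r s m l \<gamma> T"
    unfolding F_def f_fun_def
  proof (rule prod_dvd_prod)
    fix i assume i: "i \<in> {1..r}"
    have "c_fun r s m l \<gamma> i T = C i E" by (simp add: c_fun_def n_fun_def C_def E_def)
    then show "C i G dvd c_fun r s m l \<gamma> i T" using V(5)[OF i] C_cong[OF i] by simp
  qed
  moreover have "g_fun r s m l \<gamma> b 1 S = F * shift_factor \<gamma> b"
  proof (cases "b = 0")
    case True
    then show ?thesis
      using c_other by (simp add: g_fun_def f_fun_def F_def shift_factor_def)
  next
    case False
    then have bB: "b \<in> {1..r}" using b by auto
    have mbB: "m b \<in> block b" using bB m_less[of "b - 1" b] by auto
    define B where "B = {m (b - 1)<..<m b}"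
    have split: "block b = insert (m b) B" "m b \<notin> B" "finite B"
      using mbB by (auto simp: B_def)
    have exB: "row_excess ?la S h = G h" if "h \<in> B" for h
      using ex[of h] that split block_subset[OF bB] by auto
    have exb: "row_excess ?la S (m b) = G (m b) - 1"
      using ex[of "m b"] mbB block_subset[OF bB] by auto
    have G1: "G (m b) \<ge> 1" using mb fin by (auto simp: G_def Suc_le_eq card_gt_0_iff)
    have sumG: "(\<Sum>h\<in>block b. G h) = G (m b) + (\<Sum>h\<in>B. G h)" using split by simp
    have "(\<Sum>h\<in>block b. G h) \<le> s" using V(4)[OF bB] U[OF bB] by (simp add: G_def)
    moreover have "n_fun r s m l b S = G (m b) - 1 + (\<Sum>h\<in>B. G h)"
      unfolding n_fun_def split(1) using split exB exb by simp
    \<comment> \<open>The cut makes \<open>n_fun\<close> smaller by 1, which the extra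
      \<open>- 1\<close> compensates. No truncation interferes, since path 0 makes
      \<open>G (m b)\<close> positive and the block carries at most \<open>s\<close> paths.\<close>
    ultimately have n: "s - n_fun r s m l b S - 1 = s - (\<Sum>h\<in>block b. G h)"
      using G1 sumG by simp
    have Cb: "C b G = falling (\<gamma> b) (s - n_fun r s m l b S - 1) *
        fact (row_excess ?la S (m b) + 1) * (\<Prod>j\<in>B. fact (row_excess ?la S j))"
      unfolding C_def n using split exB exb G1 by simp
    have "F = C b G * (\<Prod>i\<in>{1..r} - {b}. C i G)"
      unfolding F_def using bB by (simp add: prod.remove)
    then show ?thesis
      using False c_other Cb b by (simp add: g_fun_def shift_factor_def B_def)
  qed
  ultimately show ?thesis using that S by blast
qed

text \<open>This makes \<open>t = 1\<close> an admissible shift for every \<open>b\<close>.\<close>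

lemma part_mu_pos:
  assumes "b \<le> r" shows "1 \<le> part (mu r s m l) (m b + 1)"
  using assms s m_ge_1[of b] m_le[of b r] L_ge_s[of "m b + 1"] by (auto simp: part_mu)

end

section \<open>Deriving the congruences\<close>

theorem proposition5p2:
  fixes p r s e :: nat
    and m l :: "nat \<Rightarrow> nat"
    and \<gamma> :: "nat \<Rightarrow> int"
  assumes "prime p"
    and "r \<ge> 1"
    and "s \<ge> 1"
    and "m 0 = 1"
    and "\<And>i. i < r \<Longrightarrow> m i < m (i + 1)"
    and "l 0 \<ge> l 1"
    and "\<And>i. 1 \<le> i \<Longrightarrow> i < r \<Longrightarrow> l i > l (i + 1)"
    and "l r \<ge> s"
    and "e > 0"
    and "\<exists>T. tableau_of_type (lam r s m l) (part (mu r s m l)) T \<and>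
             pseudo_standard (lam r s m l) T \<and> nice r s m l T \<and>
             \<not> int p ^ e dvd f_fun r s m l \<gamma> T"
    and "\<And>i t S. i \<le> r \<Longrightarrow> 1 \<le> t \<Longrightarrow> t \<le> part (mu r s m l) (m i + 1) \<Longrightarrow>
           tableau_of_type (lam r s m l) (shifted_type (mu r s m l) (m i) t) S \<Longrightarrow>
           pseudo_standard (lam r s m l) S \<Longrightarrow>
           int p ^ e dvd g_fun r s m l \<gamma> i t S"
  shows "(\<forall>i\<in>{1..r}. [\<gamma> i = int (l 0) - int (l i) + int (m i) + int s - 1] (mod int p)) \<and>
         [int (l 0) + int (m r) = 0] (mod int p)"
proof -
  interpret block_partition r s m l
    using assms by unfold_locales auto
  obtain T where T: "tableau_of_type (lam r s m l) (part (mu r s m l)) T"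
    "pseudo_standard (lam r s m l) T" "\<not> int p ^ e dvd f_fun r s m l \<gamma> T"
    using assms(10) by blast
  \<comment> \<open>If \<open>p\<close> did not divide the factor, it would be coprime to
    \<open>p ^ e\<close>, so \<open>p ^ e\<close> would divide \<open>F\<close> and with it
    \<open>f_fun\<close> at \<open>T\<close>.\<close>
  have dvd: "int p dvd shift_factor \<gamma> b" if b: "b \<le> r" for b
  proof (rule ccontr)
    assume ndvd: "\<not> int p dvd shift_factor \<gamma> b"
    obtain S F where S:
      "tableau_of_type (lam r s m l) (shifted_type (mu r s m l) (m b) 1) S"
      "pseudo_standard (lam r s m l) S"
      "F dvd f_fun r s m l \<gamma> T"
      "g_fun r s m l \<gamma> b 1 S = F * shift_factor \<gamma> b"
      using shift_tableau_exists[OF T(1,2) b] .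
    have "int p ^ e dvd F * shift_factor \<gamma> b"
      using assms(11)[OF b _ part_mu_pos[OF b] S(1,2)] S(4) by simp
    moreover have "coprime (int p ^ e) (shift_factor \<gamma> b)"
      using ndvd \<open>prime p\<close> by (simp add: prime_imp_coprime)
    ultimately have "int p ^ e dvd F" by (simp add: coprime_dvd_mult_left_iff)
    then show False using S(3) T(3) dvd_trans by blast
  qed
  \<comment> \<open>The factor for \<open>b = 0\<close> is, up to sign, the claim for
    \<open>i = 1\<close>; each factor with \<open>0 < b < r\<close> is the difference of the claims
    for \<open>b\<close> and \<open>b + 1\<close>.\<close>
  have cong: "int p dvd \<gamma> i - (int (l 0) - int (l i) + int (m i) + int s - 1)" if "1 \<le> i" "i \<le> r" for i
    using that
  proof (induction i rule: nat_induct_at_least)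
    case base
    have "\<gamma> 1 - (int (l 0) - int (l 1) + int (m 1) + int s - 1) = - shift_factor \<gamma> 0"
      by (simp add: shift_factor_def)
    then show ?case using dvd[of 0] by (metis dvd_minus_iff le0)
  next
    case (Suc i)
    have "\<gamma> (Suc i) - (int (l 0) - int (l (Suc i)) + int (m (Suc i)) + int s - 1) =
        (\<gamma> i - (int (l 0) - int (l i) + int (m i) + int s - 1)) - shift_factor \<gamma> i"
      using Suc by (simp add: shift_factor_def)
    then show ?case using Suc dvd[of i] by (metis Suc_leD dvd_diff)
  qed
  \<comment> \<open>Subtracting the claim for \<open>r\<close> from the factor for
    \<open>b = r\<close> cancels \<open>\<gamma> r\<close>, \<open>l r\<close> and
    \<open>s\<close>.\<close>
  have "int (l 0) + int (m r) =
      shift_factor \<gamma> r - (\<gamma> r - (int (l 0) - int (l r) + int (m r) + int s - 1))"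
    using r by (simp add: shift_factor_def)
  then have "int p dvd int (l 0) + int (m r)" using dvd[of r] cong[of r] r by (metis dvd_diff le_refl)
  then show ?thesis using cong by (auto simp: cong_iff_dvd_diff)
qed

end
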